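(* Let $C$ and $D$ be categories, $I$ a small category, and $F\colon C\to D$ a functor. Define $F^I\colon C^I\to D^I$ by sending an object $(\{A^i\},\{\alpha^{ij}\})$ to $(\{F(A^i)\},\{F(\alpha^{ij})\})$ and a morphism $\{f^i\}\colon(\{A^i\},\{\alpha^{ij}\})\to(\{B^i\},\{\beta^{ij}\})$ to $\{F(f^i)\}\colon(\{F(A^i)\},\{F(\alpha^{ij})\})\to(\{F(B^i)\},\{F(\beta^{ij})\})$. Then $F^I$ is a functor (called the exponent of $F$ by $I$).
   Context: $C^I$ denotes the category of functors $I\to C$ with natural transformations as morphisms. An object of $C^I$ is written $(\{A^i\},\{\alpha^{ij}\})$, where $A^i\in C$ is its value at $i\in I$ and $\alpha^{ij}\colon A^i\to A^j$ is its value at a morphism $i\to j$ of $I$ (there is one such $\alpha^{ij}$ for each morphism $i\to j$, possibly several for given $i,j$). A morphism $f$ in $C^I$ is written $\{f^i\}$, with $f^i\colon A^i\to B^i$ satisfying $\beta^{ij}f^i=f^j\alpha^{ij}$ for every morphism $i\to j$ of $I$. *)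

theory Defs
  imports "HOL-Library.FuncSet"
begin

(* Objects and arrows are given by carrier sets. The operations are total HOL functions whose
   values outside the carriers are irrelevant. In particular every such category has a set of
   arrows, so "small" needs no separate predicate. *)

record ('o, 'a) cat =
  Obj :: "'o set"
  Arr :: "'a set"
  Dom :: "'a \<Rightarrow> 'o"
  Cod :: "'a \<Rightarrow> 'o"
  Ident :: "'o \<Rightarrow> 'a"
  Comp :: "'a \<Rightarrow> 'a \<Rightarrow> 'a"  (* Comp C g f is g after f *)

definition Hom :: "('o, 'a) cat \<Rightarrow> 'o \<Rightarrow> 'o \<Rightarrow> 'a set" where
  "Hom C A B = {f \<in> Arr C. Dom C f = A \<and> Cod C f = B}"

locale category =
  fixes C :: "('o, 'a) cat"
  assumes Dom_in: "f \<in> Arr C \<Longrightarrow> Dom C f \<in> Obj C"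
    and Cod_in: "f \<in> Arr C \<Longrightarrow> Cod C f \<in> Obj C"
    and Ident_in: "A \<in> Obj C \<Longrightarrow> Ident C A \<in> Hom C A A"
    and Comp_in: "\<lbrakk>f \<in> Hom C X Y; g \<in> Hom C Y Z\<rbrakk> \<Longrightarrow> Comp C g f \<in> Hom C X Z"
    and Comp_Ident: "f \<in> Hom C X Y \<Longrightarrow> Comp C f (Ident C X) = f"
    and Ident_Comp: "f \<in> Hom C X Y \<Longrightarrow> Comp C (Ident C Y) f = f"
    and Comp_assoc: "\<lbrakk>f \<in> Hom C W X; g \<in> Hom C X Y; h \<in> Hom C Y Z\<rbrakk>
      \<Longrightarrow> Comp C h (Comp C g f) = Comp C (Comp C h g) f"

record ('o, 'a, 'p, 'b) func =
  ObjMap :: "'o \<Rightarrow> 'p"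
  ArrMap :: "'a \<Rightarrow> 'b"

locale cat_functor = source: category C + target: category D
  for C :: "('o, 'a) cat" and D :: "('p, 'b) cat" +
  fixes F :: "('o, 'a, 'p, 'b) func"
  assumes ObjMap_in: "A \<in> Obj C \<Longrightarrow> ObjMap F A \<in> Obj D"
    and ArrMap_in: "f \<in> Hom C A B \<Longrightarrow> ArrMap F f \<in> Hom D (ObjMap F A) (ObjMap F B)"
    and ArrMap_Ident: "A \<in> Obj C \<Longrightarrow> ArrMap F (Ident C A) = Ident D (ObjMap F A)"
    and ArrMap_Comp: "\<lbrakk>f \<in> Hom C X Y; g \<in> Hom C Y Z\<rbrakk>
      \<Longrightarrow> ArrMap F (Comp C g f) = Comp D (ArrMap F g) (ArrMap F f)"

locale nat_transformation = dom: cat_functor I C A + cod: cat_functor I C B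
  for I :: "('i, 'u) cat" and C :: "('o, 'a) cat"
    and A B :: "('i, 'u, 'o, 'a) func" +
  fixes t :: "'i \<Rightarrow> 'a"
  assumes component_in: "i \<in> Obj I \<Longrightarrow> t i \<in> Hom C (ObjMap A i) (ObjMap B i)"
    and naturality: "u \<in> Hom I i j
      \<Longrightarrow> Comp C (ArrMap B u) (t i) = Comp C (t j) (ArrMap A u)"

(* An arrow of the functor category is a family of components together with its source and
   target functors, which the family alone does not determine. *)

record ('i, 'u, 'o, 'a) nat_trans =
  Source :: "('i, 'u, 'o, 'a) func"
  Target :: "('i, 'u, 'o, 'a) func"
  Component :: "'i \<Rightarrow> 'a"

(* Inside the functor category, functors and natural transformations are normalised by
   extensionality (value undefined outside the carriers of I), so that HOL equality
   is equality of functors and of natural transformations on I. *)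

definition functor_category ::
  "('i, 'u) cat \<Rightarrow> ('o, 'a) cat \<Rightarrow> (('i, 'u, 'o, 'a) func, ('i, 'u, 'o, 'a) nat_trans) cat" where
  "functor_category I C =
    \<lparr>Obj = {A. cat_functor I C A \<and> ObjMap A \<in> extensional (Obj I) \<and> ArrMap A \<in> extensional (Arr I)},
     Arr = {f. nat_transformation I C (Source f) (Target f) (Component f)
               \<and> ObjMap (Source f) \<in> extensional (Obj I) \<and> ArrMap (Source f) \<in> extensional (Arr I)
               \<and> ObjMap (Target f) \<in> extensional (Obj I) \<and> ArrMap (Target f) \<in> extensional (Arr I)
               \<and> Component f \<in> extensional (Obj I)},
     Dom = Source,
     Cod = Target,
     Ident = (\<lambda>A. \<lparr>Source = A, Target = A, Component = (\<lambda>i\<in>Obj I. Ident C (ObjMap A i))\<rparr>),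
     Comp = (\<lambda>g f. \<lparr>Source = Source f, Target = Target g,
                    Component = (\<lambda>i\<in>Obj I. Comp C (Component g i) (Component f i))\<rparr>)\<rparr>"

definition exponent_obj ::
  "('i, 'u) cat \<Rightarrow> ('o, 'a, 'p, 'b) func \<Rightarrow> ('i, 'u, 'o, 'a) func \<Rightarrow> ('i, 'u, 'p, 'b) func" where
  "exponent_obj I F A =
    \<lparr>ObjMap = (\<lambda>i\<in>Obj I. ObjMap F (ObjMap A i)),
     ArrMap = (\<lambda>u\<in>Arr I. ArrMap F (ArrMap A u))\<rparr>"

definition exponent_arr ::
  "('i, 'u) cat \<Rightarrow> ('o, 'a, 'p, 'b) func
    \<Rightarrow> ('i, 'u, 'o, 'a) nat_trans \<Rightarrow> ('i, 'u, 'p, 'b) nat_trans" where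
  "exponent_arr I F f =
    \<lparr>Source = exponent_obj I F (Source f),
     Target = exponent_obj I F (Target f),
     Component = (\<lambda>i\<in>Obj I. ArrMap F (Component f i))\<rparr>"

definition exponent ::
  "('i, 'u) cat \<Rightarrow> ('o, 'a, 'p, 'b) func
    \<Rightarrow> (('i, 'u, 'o, 'a) func, ('i, 'u, 'o, 'a) nat_trans,
        ('i, 'u, 'p, 'b) func, ('i, 'u, 'p, 'b) nat_trans) func" where
  "exponent I F = \<lparr>ObjMap = exponent_obj I F, ArrMap = exponent_arr I F\<rparr>"

end

theory Submission imports Defs begin

text \<open>Everything about \<open>F^I\<close> is checked one index at a time. Composing
  \<open>F\<close> with a diagram \<open>A\<close> gives a diagram in \<open>D\<close>
  (\<open>cat_functor_exponent_obj\<close>). Since \<open>F\<close> preserves commutative squares,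
  it carries the naturality squares of a transformation to naturality squares
  (\<open>nat_transformation_exponent\<close>). Identities and composites in a functor category are
  formed componentwise, so preserving them amounts, at each \<open>i\<close>, to the laws of
  \<open>F\<close> in \<open>C\<close>. A \<open>cat_functor\<close> also requires its source and
  target to be categories. \<open>category_functor_category\<close> provides this, and its main
  ingredient is vertical composition, \<open>nat_transformation_Comp\<close>.\<close>

lemma (in category) HomD:
  assumes "f \<in> Hom C X Y"
  shows "f \<in> Arr C" "X \<in> Obj C" "Y \<in> Obj C"
  using assms Dom_in Cod_in by (auto simp: Hom_def)

lemma Obj_functor_category:
  "A \<in> Obj (functor_category I C) \<longleftrightarrow>
    cat_functor I C A \<and> ObjMap A \<in> extensional (Obj I) \<and> ArrMap A \<in> extensional (Arr I)"
  by (simp add: functor_category_def)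

text \<open>The locale \<open>nat_transformation\<close> already contains the functoriality of both
  ends. Together with the extensionality conditions on arrows, this places source and target among
  the objects.\<close>

lemma Hom_functor_category:
  "f \<in> Hom (functor_category I C) A B \<longleftrightarrow>
    Source f = A \<and> Target f = B \<and> nat_transformation I C A B (Component f)
    \<and> A \<in> Obj (functor_category I C) \<and> B \<in> Obj (functor_category I C)
    \<and> Component f \<in> extensional (Obj I)"
  by (auto simp: functor_category_def Hom_def nat_transformation_def)

lemma Ident_functor_category:
  "Ident (functor_category I C) A =
    \<lparr>Source = A, Target = A, Component = (\<lambda>i\<in>Obj I. Ident C (ObjMap A i))\<rparr>"
  by (simp add: functor_category_def)

lemma Comp_functor_category:
  "Comp (functor_category I C) g f =
    \<lparr>Source = Source f, Target = Target g,
     Component = (\<lambda>i\<in>Obj I. Comp C (Component g i) (Component f i))\<rparr>"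
  by (simp add: functor_category_def)

lemma nat_transformation_Ident:
  assumes "cat_functor I C A"
  shows "nat_transformation I C A A (\<lambda>i\<in>Obj I. Ident C (ObjMap A i))"
proof -
  interpret A: cat_functor I C A by fact
  show ?thesis
  proof unfold_locales
    fix i assume "i \<in> Obj I"
    then show "(\<lambda>i\<in>Obj I. Ident C (ObjMap A i)) i \<in> Hom C (ObjMap A i) (ObjMap A i)"
      by (simp add: A.ObjMap_in A.target.Ident_in)
  next
    fix u i j assume u: "u \<in> Hom I i j"
    note A.source.HomD[OF u] A.ArrMap_in[OF u]
    then show "Comp C (ArrMap A u) ((\<lambda>i\<in>Obj I. Ident C (ObjMap A i)) i)
        = Comp C ((\<lambda>i\<in>Obj I. Ident C (ObjMap A i)) j) (ArrMap A u)"
      by (simp add: A.target.Comp_Ident A.target.Ident_Comp)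
  qed
qed

text \<open>Vertical composition: the naturality squares of \<open>s\<close> and \<open>t\<close>
  over \<open>u\<close> share the edge \<open>ArrMap Y u\<close>, and pasting them along it gives
  the square of the composite. Associativity in \<open>C\<close> does the rebracketing.\<close>

lemma nat_transformation_Comp:
  assumes "nat_transformation I C X Y s" and "nat_transformation I C Y Z t"
  shows "nat_transformation I C X Z (\<lambda>i\<in>Obj I. Comp C (t i) (s i))"
proof -
  interpret s: nat_transformation I C X Y s by fact
  interpret t: nat_transformation I C Y Z t by fact
  note assoc = s.dom.target.Comp_assoc
  show ?thesis
  proof unfold_locales
    fix i assume "i \<in> Obj I"
    then show "(\<lambda>i\<in>Obj I. Comp C (t i) (s i)) i \<in> Hom C (ObjMap X i) (ObjMap Z i)"
      using s.component_in t.component_in s.dom.target.Comp_in by fastforce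
  next
    fix u i j assume u: "u \<in> Hom I i j"
    note ij = s.dom.source.HomD[OF u]
    note si = s.component_in[OF ij(2)] and sj = s.component_in[OF ij(3)]
    note ti = t.component_in[OF ij(2)] and tj = t.component_in[OF ij(3)]
    note Xu = s.dom.ArrMap_in[OF u] and Yu = s.cod.ArrMap_in[OF u] and Zu = t.cod.ArrMap_in[OF u]
    have "Comp C (ArrMap Z u) (Comp C (t i) (s i)) = Comp C (Comp C (t j) (ArrMap Y u)) (s i)"
      by (simp add: assoc[OF si ti Zu] t.naturality[OF u])
    also have "\<dots> = Comp C (t j) (Comp C (s j) (ArrMap X u))"
      by (simp add: assoc[OF si Yu tj, symmetric] s.naturality[OF u])
    also have "\<dots> = Comp C (Comp C (t j) (s j)) (ArrMap X u)"
      by (rule assoc[OF Xu sj tj])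
    finally show "Comp C (ArrMap Z u) ((\<lambda>i\<in>Obj I. Comp C (t i) (s i)) i)
        = Comp C ((\<lambda>i\<in>Obj I. Comp C (t i) (s i)) j) (ArrMap X u)"
      using ij by simp
  qed
qed

lemma Component_in_Hom:
  assumes "f \<in> Hom (functor_category I C) A B" and "i \<in> Obj I"
  shows "Component f i \<in> Hom C (ObjMap A i) (ObjMap B i)"
  using assms nat_transformation.component_in by (auto simp: Hom_functor_category)

text \<open>Each law is inherited from \<open>C\<close> at every index. Extensionality turns
  agreement on \<open>Obj I\<close> into HOL equality of the records.\<close>

lemma category_functor_category:
  assumes "category C"
  shows "category (functor_category I C)"
proof -
  interpret C: category C by fact
  show ?thesis
  proof
    fix f assume "f \<in> Arr (functor_category I C)"
    then have "f \<in> Hom (functor_category I C)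
        (Dom (functor_category I C) f) (Cod (functor_category I C) f)"
      by (simp add: Hom_def)
    then show "Dom (functor_category I C) f \<in> Obj (functor_category I C)"
      and "Cod (functor_category I C) f \<in> Obj (functor_category I C)"
      by (simp_all add: Hom_functor_category)
  next
    fix A assume "A \<in> Obj (functor_category I C)"
    then show "Ident (functor_category I C) A \<in> Hom (functor_category I C) A A"
      by (simp add: Hom_functor_category Ident_functor_category Obj_functor_category
          nat_transformation_Ident)
  next
    fix f g X Y Z
    assume "f \<in> Hom (functor_category I C) X Y" "g \<in> Hom (functor_category I C) Y Z"
    then show "Comp (functor_category I C) g f \<in> Hom (functor_category I C) X Z"
      by (auto simp: Hom_functor_category Comp_functor_category intro: nat_transformation_Comp)
  next
    fix f X Y assume f: "f \<in> Hom (functor_category I C) X Y"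
    then have st: "Source f = X" "Target f = Y" "Component f \<in> extensional (Obj I)"
      by (simp_all add: Hom_functor_category)
    \<comment> \<open>Composition restricts its result to \<open>Obj I\<close>, so recovering
      \<open>f\<close> itself also requires its component family to be extensional there.\<close>
    note [simp] = Component_in_Hom[OF f, THEN C.Comp_Ident]
      Component_in_Hom[OF f, THEN C.Ident_Comp]
    show "Comp (functor_category I C) f (Ident (functor_category I C) X) = f"
      by (auto simp: st Comp_functor_category Ident_functor_category
          intro!: nat_trans.equality extensionalityI[of _ "Obj I"])
    show "Comp (functor_category I C) (Ident (functor_category I C) Y) f = f"
      by (auto simp: st Comp_functor_category Ident_functor_category
          intro!: nat_trans.equality extensionalityI[of _ "Obj I"])
  next
    fix f g h W X Y Z
    assume "f \<in> Hom (functor_category I C) W X" "g \<in> Hom (functor_category I C) X Y"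
      "h \<in> Hom (functor_category I C) Y Z"
    note this[THEN Component_in_Hom]
    then show "Comp (functor_category I C) h (Comp (functor_category I C) g f)
        = Comp (functor_category I C) (Comp (functor_category I C) h g) f"
      by (auto simp: Comp_functor_category intro!: restrict_ext C.Comp_assoc)
  qed
qed

text \<open>This is the composite of two functors, cut down to the carriers of \<open>I\<close>. The
  restriction is harmless because identities and composites of \<open>I\<close> stay in
  \<open>Arr I\<close>.\<close>

lemma cat_functor_exponent_obj:
  assumes "cat_functor C D F" and "cat_functor I C A"
  shows "cat_functor I D (exponent_obj I F A)"
proof -
  interpret F: cat_functor C D F by fact
  interpret A: cat_functor I C A by fact
  show ?thesis
  proof
    fix i assume i: "i \<in> Obj I"
    then show "ObjMap (exponent_obj I F A) i \<in> Obj D"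
      by (simp add: exponent_obj_def A.ObjMap_in F.ObjMap_in)
    from i show "ArrMap (exponent_obj I F A) (Ident I i) = Ident D (ObjMap (exponent_obj I F A) i)"
      using A.source.HomD[OF A.source.Ident_in[OF i]]
      by (simp add: exponent_obj_def A.ObjMap_in A.ArrMap_Ident F.ArrMap_Ident)
  next
    fix u i j assume u: "u \<in> Hom I i j"
    then show "ArrMap (exponent_obj I F A) u
        \<in> Hom D (ObjMap (exponent_obj I F A) i) (ObjMap (exponent_obj I F A) j)"
      using A.source.HomD[OF u] by (simp add: exponent_obj_def A.ArrMap_in F.ArrMap_in)
  next
    fix u v i j k assume uv: "u \<in> Hom I i j" "v \<in> Hom I j k"
    \<comment> \<open>All three arrows, the composite included, must lie in \<open>Arr I\<close> for
      the restricted arrow map to unfold to \<open>F\<close> after \<open>A\<close>.\<close>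
    note uv[THEN A.source.HomD(1)] A.source.HomD(1)[OF A.source.Comp_in[OF uv]]
    then show "ArrMap (exponent_obj I F A) (Comp I v u)
        = Comp D (ArrMap (exponent_obj I F A) v) (ArrMap (exponent_obj I F A) u)"
      by (simp add: exponent_obj_def A.ArrMap_Comp[OF uv] F.ArrMap_Comp[OF uv[THEN A.ArrMap_in]])
  qed
qed

lemma nat_transformation_exponent:
  assumes "cat_functor C D F" and "nat_transformation I C A B t"
  shows "nat_transformation I D (exponent_obj I F A) (exponent_obj I F B)
    (\<lambda>i\<in>Obj I. ArrMap F (t i))"
proof -
  interpret F: cat_functor C D F by fact
  interpret t: nat_transformation I C A B t by fact
  interpret FA: cat_functor I D "exponent_obj I F A"
    by (intro cat_functor_exponent_obj[of C]) unfold_locales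
  interpret FB: cat_functor I D "exponent_obj I F B"
    by (intro cat_functor_exponent_obj[of C]) unfold_locales
  show ?thesis
  proof unfold_locales
    fix i assume "i \<in> Obj I"
    then show "(\<lambda>i\<in>Obj I. ArrMap F (t i)) i
        \<in> Hom D (ObjMap (exponent_obj I F A) i) (ObjMap (exponent_obj I F B) i)"
      by (simp add: exponent_obj_def t.component_in F.ArrMap_in)
  next
    fix u i j assume u: "u \<in> Hom I i j"
    note ij = t.dom.source.HomD[OF u]
    have "Comp D (ArrMap F (ArrMap B u)) (ArrMap F (t i))
        = Comp D (ArrMap F (t j)) (ArrMap F (ArrMap A u))"
      \<comment> \<open>The two sides are \<open>F\<close> applied to the two paths around the
        naturality square of \<open>t\<close> over \<open>u\<close>, and these paths are equal in
        \<open>C\<close>.\<close>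
      using F.ArrMap_Comp[OF t.component_in[OF ij(2)] t.cod.ArrMap_in[OF u]]
        F.ArrMap_Comp[OF t.dom.ArrMap_in[OF u] t.component_in[OF ij(3)]]
      by (simp add: t.naturality[OF u])
    then show "Comp D (ArrMap (exponent_obj I F B) u) ((\<lambda>i\<in>Obj I. ArrMap F (t i)) i)
        = Comp D ((\<lambda>i\<in>Obj I. ArrMap F (t i)) j) (ArrMap (exponent_obj I F A) u)"
      using ij by (simp add: exponent_obj_def)
  qed
qed

lemma exponent_obj_in:
  assumes "cat_functor C D F" and "A \<in> Obj (functor_category I C)"
  shows "exponent_obj I F A \<in> Obj (functor_category I D)"
  using assms cat_functor_exponent_obj[of C D F I A]
  \<comment> \<open>\<open>exponent_obj\<close> stays folded until the functoriality lemma has been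
    applied. Unfolding it afterwards settles extensionality.\<close>
  by (simp add: Obj_functor_category) (simp add: exponent_obj_def)

theorem proposition1p2:
  fixes C :: "('o, 'a) cat" and D :: "('p, 'b) cat" and I :: "('i, 'u) cat"
    and F :: "('o, 'a, 'p, 'b) func"
  assumes "category C" and "category D" and "category I"
    and "cat_functor C D F"
  shows "cat_functor (functor_category I C) (functor_category I D) (exponent I F)"
proof -
  interpret F: cat_functor C D F by fact
  interpret CI: category "functor_category I C"
    using assms(1) by (rule category_functor_category)
  interpret DI: category "functor_category I D"
    using assms(2) by (rule category_functor_category)
  show ?thesis
  proof
    fix A assume A: "A \<in> Obj (functor_category I C)"
    then show "ObjMap (exponent I F) A \<in> Obj (functor_category I D)"
      by (simp add: exponent_def exponent_obj_in[OF assms(4)])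
    \<comment> \<open>This is the premise under which \<open>F\<close> preserves the identity of
      \<open>ObjMap A i\<close>, the component at \<open>i\<close> of the identity
      transformation.\<close>
    from A have "ObjMap A i \<in> Obj C" if "i \<in> Obj I" for i
      using that by (auto simp: Obj_functor_category dest: cat_functor.ObjMap_in)
    then show "ArrMap (exponent I F) (Ident (functor_category I C) A)
        = Ident (functor_category I D) (ObjMap (exponent I F) A)"
      by (auto simp: exponent_def exponent_arr_def exponent_obj_def Ident_functor_category
          F.ArrMap_Ident intro!: restrict_ext)
  next
    fix f A B assume "f \<in> Hom (functor_category I C) A B"
    then show "ArrMap (exponent I F) f
        \<in> Hom (functor_category I D) (ObjMap (exponent I F) A) (ObjMap (exponent I F) B)"
      by (auto simp: Hom_functor_category exponent_def exponent_arr_def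
          intro: exponent_obj_in[OF assms(4)] nat_transformation_exponent[OF assms(4)])
  next
    fix f g X Y Z
    assume "f \<in> Hom (functor_category I C) X Y" "g \<in> Hom (functor_category I C) Y Z"
    \<comment> \<open>At each \<open>i\<close> the components are composable through
      \<open>ObjMap Y i\<close>, so \<open>F.ArrMap_Comp\<close> applies index by index.\<close>
    note this[THEN Component_in_Hom]
    then show "ArrMap (exponent I F) (Comp (functor_category I C) g f)
        = Comp (functor_category I D) (ArrMap (exponent I F) g) (ArrMap (exponent I F) f)"
      by (auto simp: exponent_def exponent_arr_def Comp_functor_category
          intro!: restrict_ext F.ArrMap_Comp)
  qed
qed

end
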